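(* A semigroup $S$ is a T2R semigroup if and only if it satisfies all of the following conditions. (1) $S$ is a semilattice of a non-trivial nil semigroup $S_0$ and a two-element right zero semigroup $S_1$ such that $S_0S_1\subseteq S_0$. (2) The ideals of $S$ form a chain with respect to inclusion. (3) For each $b\in S_0$, either $b\in bS_1$ or $bS_1\subseteq S^1bS_0$. (4) For each $b\in S_0$, either $\{b\}=S_1b$ or $S_1b\cap (S_0bS^1\cup S^1bS_0)\neq\emptyset$. (5) For each $b\in S$, if $|J_b|=2$, $I(b)\neq\{0\}$ and $a\in I(b)$, then there are elements $x,y\in S^1$ such that $xJ_by\cap J_a\neq\emptyset$ and $xJ_by\not\subseteq J_a$.
   Context: A semigroup $S$ is a $\Delta$-semigroup if the lattice of all congruences of $S$ is a chain with respect to inclusion. A semigroup $N$ with zero $0$ is nil if every element has some power equal to $0$; it is non-trivial if it has more than one element. A semigroup $S$ is a semilattice of a subsemigroup $S_0$ (which is an ideal) and a subsemigroup $S_1$ if $S$ is the disjoint union $S_0\cup S_1$, $S_0$ is an ideal of $S$ and $S_1$ is a subsemigroup (so $S/S_0$ is the two-element semilattice). A right zero semigroup satisfies $xy=y$ for all $x,y$. A T2R semigroup is a $\Delta$-semigroup $S$ which is a semilattice of a non-trivial nil ideal $S_0$ and a subsemigroup $S_1$ which is a two-element right zero semigroup. $S^1$ denotes $S$ with an identity element $1$ adjoined. For $a\in S$: $J(a)=S^1aS^1$, $J_a=\{s\in S: J(s)=J(a)\}$, and $I(a)=J(a)\setminus J_a$. For $x,y\in S^1$ and $A\subseteq S$,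 $xAy=\{xay: a\in A\}$. $0$ denotes the zero of $S_0$ (which is the zero of $S$). *)

theory Defs
  imports Main
begin

text \<open>A semigroup is modelled as a type of class semigroup_mult (the whole type is the
carrier). Elements of S^1 are modelled as 'a option, None being the adjoined identity 1.\<close>

definition congruence :: "('a::semigroup_mult) rel \<Rightarrow> bool" where
  "congruence r \<longleftrightarrow> equiv UNIV r \<and>
     (\<forall>a b c. (a, b) \<in> r \<longrightarrow> (c * a, c * b) \<in> r \<and> (a * c, b * c) \<in> r)"

definition Delta_semigroup :: "'a::semigroup_mult itself \<Rightarrow> bool" where
  "Delta_semigroup _ \<longleftrightarrow>
     (\<forall>r s :: 'a rel. congruence r \<and> congruence s \<longrightarrow> r \<subseteq> s \<or> s \<subseteq> r)"

definition subsemigroup :: "('a::semigroup_mult) set \<Rightarrow> bool" where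
  "subsemigroup A \<longleftrightarrow> (\<forall>x\<in>A. \<forall>y\<in>A. x * y \<in> A)"

definition ideal :: "('a::semigroup_mult) set \<Rightarrow> bool" where
  "ideal I \<longleftrightarrow> I \<noteq> {} \<and> (\<forall>s x. x \<in> I \<longrightarrow> s * x \<in> I \<and> x * s \<in> I)"

fun spow :: "'a::semigroup_mult \<Rightarrow> nat \<Rightarrow> 'a" where
  "spow x 0 = x"
| "spow x (Suc n) = spow x n * x"

definition nil_with_zero :: "('a::semigroup_mult) set \<Rightarrow> 'a \<Rightarrow> bool" where
  "nil_with_zero A z \<longleftrightarrow> subsemigroup A \<and> z \<in> A \<and>
     (\<forall>x\<in>A. x * z = z \<and> z * x = z) \<and> (\<forall>x\<in>A. \<exists>n. spow x n = z)"

definition nontrivial :: "'a set \<Rightarrow> bool" where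
  "nontrivial A \<longleftrightarrow> (\<exists>x\<in>A. \<exists>y\<in>A. x \<noteq> y)"

definition right_zero :: "('a::semigroup_mult) set \<Rightarrow> bool" where
  "right_zero A \<longleftrightarrow> (\<forall>x\<in>A. \<forall>y\<in>A. x * y = y)"

definition semilattice_of :: "('a::semigroup_mult) set \<Rightarrow> 'a set \<Rightarrow> bool" where
  "semilattice_of S0 S1 \<longleftrightarrow> S0 \<inter> S1 = {} \<and> S0 \<union> S1 = UNIV \<and> ideal S0 \<and> subsemigroup S1"

definition T2R :: "'a::semigroup_mult itself \<Rightarrow> bool" where
  "T2R t \<longleftrightarrow> Delta_semigroup t \<and>
     (\<exists>(S0::'a set) S1 z. semilattice_of S0 S1 \<and> nil_with_zero S0 z \<and> nontrivial S0 \<and>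
        right_zero S1 \<and> card S1 = 2)"

fun lmul :: "('a::semigroup_mult) option \<Rightarrow> 'a \<Rightarrow> 'a" where
  "lmul None a = a"
| "lmul (Some x) a = x * a"

fun rmul :: "('a::semigroup_mult) \<Rightarrow> 'a option \<Rightarrow> 'a" where
  "rmul a None = a"
| "rmul a (Some y) = a * y"

definition sandwich :: "('a::semigroup_mult) option \<Rightarrow> 'a set \<Rightarrow> 'a option \<Rightarrow> 'a set" where
  "sandwich x A y = {lmul x (rmul a y) | a. a \<in> A}"

definition Jid :: "'a::semigroup_mult \<Rightarrow> 'a set" where
  "Jid a = {lmul x (rmul a y) | x y. True}"

definition Jcls :: "'a::semigroup_mult \<Rightarrow> 'a set" where
  "Jcls a = {s. Jid s = Jid a}"

definition Iid :: "'a::semigroup_mult \<Rightarrow> 'a set" where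
  "Iid a = Jid a - Jcls a"

end

theory Submission
  imports Defs
begin

text \<open>Nilpotency of \<open>S0\<close> makes every J-class have at most two elements, a two-element class of
  \<open>b \<in> S0\<close> being \<open>b S1\<close>. For a Delta-semigroup, each of (3), (4), (5) follows by comparing the
  Rees congruence of a principal ideal with the syntactic congruence of a suitable set: if the
  condition failed, the two would be incomparable. Conversely, under (1)--(5) a congruence
  identifying elements of different J-classes identifies them with the zero, and a congruence
  collapsing a two-element J-class identifies everything strictly below it with the zero. Hence
  a congruence is the Rees congruence of an ideal \<open>I\<close>, possibly enlarged by collapsing the
  J-class immediately above \<open>I\<close>, and such congruences form a chain.\<close>

section \<open>Principal ideals and congruences\<close>

text \<open>The product of S^1, which turns \<open>lmul\<close> and \<open>rmul\<close> into a left
  and a right action of S^1 on S.\<close>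

fun omul :: "('a::semigroup_mult) option \<Rightarrow> 'a option \<Rightarrow> 'a option" where
  "omul None y = y"
| "omul x None = x"
| "omul (Some x) (Some y) = Some (x * y)"

lemma lmul_lmul: "lmul x (lmul y a) = lmul (omul x y) a"
  by (cases x; cases y; simp add: mult.assoc)

lemma rmul_rmul: "rmul (rmul a x) y = rmul a (omul x y)"
  by (cases x; cases y; simp add: mult.assoc)

lemma rmul_lmul: "rmul (lmul x a) y = lmul x (rmul a y)"
  by (cases x; cases y; simp add: mult.assoc)

lemma two_sided_mult:
  "lmul u (rmul (lmul x (rmul a y)) v) = lmul (omul u x) (rmul a (omul y v))"
  by (simp only: rmul_lmul rmul_rmul lmul_lmul)

lemma JidI: "lmul x (rmul a y) \<in> Jid a"
  by (auto simp: Jid_def)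

lemma JidE:
  assumes "c \<in> Jid a"
  obtains x y where "c = lmul x (rmul a y)"
  using assms by (auto simp: Jid_def)

lemma Jid_self [simp]: "a \<in> Jid a"
  using JidI[of None a None] by simp

lemma Jid_trans: "c \<in> Jid b \<Longrightarrow> b \<in> Jid a \<Longrightarrow> c \<in> Jid a"
  by (metis JidE JidI two_sided_mult)

lemma Jid_eq_iff: "Jid a = Jid b \<longleftrightarrow> a \<in> Jid b \<and> b \<in> Jid a"
  using Jid_trans Jid_self by blast

lemma mem_Jcls_iff: "a \<in> Jcls b \<longleftrightarrow> a \<in> Jid b \<and> b \<in> Jid a"
  by (auto simp: Jcls_def Jid_eq_iff)

lemma mem_Iid_iff: "a \<in> Iid b \<longleftrightarrow> a \<in> Jid b \<and> b \<notin> Jid a"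
  by (auto simp: Iid_def mem_Jcls_iff)

lemma ideal_Jid: "ideal (Jid a)"
proof -
  have "s * x \<in> Jid a \<and> x * s \<in> Jid a" if "x \<in> Jid a" for s x
    using that JidI[of "Some s" x None] JidI[of None x "Some s"] Jid_trans by auto
  then show ?thesis
    unfolding ideal_def using Jid_self by blast
qed

lemma ideal_lmul_rmul: "ideal I \<Longrightarrow> a \<in> I \<Longrightarrow> lmul x (rmul a y) \<in> I"
  by (cases x; cases y; auto simp: ideal_def)

lemma Jid_subset_ideal: "ideal I \<Longrightarrow> a \<in> I \<Longrightarrow> Jid a \<subseteq> I"
  by (auto simp: Jid_def ideal_lmul_rmul)

lemma congruence_lmul_rmul:
  "congruence r \<Longrightarrow> (a, b) \<in> r \<Longrightarrow> (lmul x (rmul a y), lmul x (rmul b y)) \<in> r"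
  by (cases x; cases y; auto simp: congruence_def)

lemma congruence_refl: "congruence r \<Longrightarrow> (a, a) \<in> r"
  by (auto simp: congruence_def equiv_def refl_on_def)

lemma congruence_sym: "congruence r \<Longrightarrow> (a, b) \<in> r \<Longrightarrow> (b, a) \<in> r"
  by (auto simp: congruence_def equiv_def dest: symD)

lemma congruence_trans: "congruence r \<Longrightarrow> (a, b) \<in> r \<Longrightarrow> (b, c) \<in> r \<Longrightarrow> (a, c) \<in> r"
  by (auto simp: congruence_def equiv_def dest: transD)

lemma congruence_Id: "congruence (Id :: ('a::semigroup_mult) rel)"
  by (auto simp: congruence_def equiv_def refl_on_def sym_def trans_def)

section \<open>Rees and syntactic congruences\<close>

definition rees :: "('a::semigroup_mult) set \<Rightarrow> 'a rel" where
  "rees I = I \<times> I \<union> Id"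

text \<open>The largest congruence for which \<open>D\<close> is a union of classes.\<close>

definition syntactic :: "('a::semigroup_mult) set \<Rightarrow> 'a rel" where
  "syntactic D = {(a, b). \<forall>x y. lmul x (rmul a y) \<in> D \<longleftrightarrow> lmul x (rmul b y) \<in> D}"

lemma congruence_rees: "ideal I \<Longrightarrow> congruence (rees I)"
  by (auto simp: congruence_def rees_def ideal_def equiv_def refl_on_def sym_def trans_def)

lemma congruence_syntactic: "congruence (syntactic D)"
proof -
  have "(c * a, c * b) \<in> syntactic D \<and> (a * c, b * c) \<in> syntactic D"
    if ab: "(a, b) \<in> syntactic D" for a b c
  proof -
    have "lmul x (rmul (lmul u (rmul a v)) y) \<in> D \<longleftrightarrow> lmul x (rmul (lmul u (rmul b v)) y) \<in> D"
      for x y u v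
      unfolding two_sided_mult using ab by (simp add: syntactic_def)
    from this[of _ "Some c" None] this[of _ None "Some c"] show ?thesis
      by (simp add: syntactic_def)
  qed
  then show ?thesis
    unfolding congruence_def
    by (auto simp: syntactic_def equiv_def refl_on_def sym_def trans_def)
qed

lemma syntactic_saturates: "(a, b) \<in> syntactic D \<Longrightarrow> a \<in> D \<longleftrightarrow> b \<in> D"
  unfolding syntactic_def
  by (metis (mono_tags, lifting) case_prodD lmul.simps(1) mem_Collect_eq rmul.simps(1))

text \<open>The Rees congruence of \<open>Jid c\<close> does not relate \<open>p\<close> and
  \<open>q\<close>, whereas the syntactic congruence of \<open>D\<close> does. In a chain the former
  must lie in the latter, so \<open>D\<close> cannot separate \<open>c\<close> from anything in its
  principal ideal. Conditions (3)--(5) use this with \<open>d\<close> the zero.\<close>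

lemma Delta_separation:
  assumes "Delta_semigroup TYPE('a::semigroup_mult)"
    and "(p, q :: 'a) \<in> syntactic D" "p \<noteq> q" "p \<notin> Jid c" "d \<in> Jid c"
  shows "c \<in> D \<longleftrightarrow> d \<in> D"
proof -
  have "(p, q) \<notin> rees (Jid c)"
    using assms by (auto simp: rees_def)
  then have "rees (Jid c) \<subseteq> syntactic D"
    using assms congruence_rees[OF ideal_Jid] congruence_syntactic
    unfolding Delta_semigroup_def by blast
  moreover have "(c, d) \<in> rees (Jid c)"
    using assms by (auto simp: rees_def)
  ultimately show ?thesis
    using syntactic_saturates by blast
qed

lemma spow_Suc_left: "spow x (Suc n) = x * spow x n"
  by (induction n) (simp_all add: mult.assoc)

section \<open>Semilattices of a nil semigroup and a two-element right zero semigroup\<close>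

locale nil_right_zero =
  fixes S0 S1 :: "('a::semigroup_mult) set" and z :: 'a
  assumes semilattice: "semilattice_of S0 S1"
    and nil: "nil_with_zero S0 z"
    and right_zero: "right_zero S1"
    and card_S1: "card S1 = 2"
begin

lemma S0_or_S1: "x \<in> S0 \<or> x \<in> S1"
  using semilattice by (auto simp: semilattice_of_def)

lemma not_S0_and_S1: "x \<in> S0 \<Longrightarrow> x \<notin> S1"
  using semilattice by (auto simp: semilattice_of_def)

lemma ideal_S0: "ideal S0"
  using semilattice by (auto simp: semilattice_of_def)

lemma S0_mult: "x \<in> S0 \<Longrightarrow> x * y \<in> S0" "y \<in> S0 \<Longrightarrow> x * y \<in> S0"
  using ideal_S0 by (auto simp: ideal_def)

lemma S1_mult: "x \<in> S1 \<Longrightarrow> y \<in> S1 \<Longrightarrow> x * y = y"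
  using right_zero by (auto simp: right_zero_def)

lemma S1_mult_left: "x \<in> S1 \<Longrightarrow> y \<in> S1 \<Longrightarrow> x * (y * a) = y * a"
  by (metis S1_mult mult.assoc)

lemma z_in_S0: "z \<in> S0"
  using nil by (auto simp: nil_with_zero_def)

text \<open>By assumption \<open>z\<close> is a zero of \<open>S0\<close> only. Since
  \<open>z * x\<close> lies in \<open>S0\<close>, one gets \<open>z * x = z * (z * x) = z\<close>,
  and dually on the other side.\<close>

lemma zero_mult [simp]: "z * x = z" "x * z = z"
proof -
  have S0: "y * z = z \<and> z * y = z" if "y \<in> S0" for y
    using nil that by (auto simp: nil_with_zero_def)
  have "z * x \<in> S0" "x * z \<in> S0"
    using S0_mult z_in_S0 by auto
  then show "z * x = z" "x * z = z"
    using S0 z_in_S0 by (metis mult.assoc)+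
qed

lemma nilpotent: "x \<in> S0 \<Longrightarrow> \<exists>n. spow x n = z"
  using nil by (auto simp: nil_with_zero_def)

lemma zero_in_Jid: "z \<in> Jid a"
  using JidI[of None a "Some z"] by simp

lemma Jid_zero: "Jid z = {z}"
proof -
  have "lmul x (rmul z y) = z" for x y
    by (cases x; cases y; simp)
  then show ?thesis
    by (auto simp: Jid_def)
qed

lemma option_cases:
  obtains "x = None" | s where "s \<in> S1" "x = Some s" | s where "s \<in> S0" "x = Some s"
  using S0_or_S1 by (cases x) auto

lemma omul_S0: "x \<in> Some ` S0 \<or> y \<in> Some ` S0 \<Longrightarrow> omul x y \<in> Some ` S0"
  by (cases x; cases y) (auto simp: S0_mult)

text \<open>The relation \<open>b \<sim> x b y\<close> can be iterated, and then powers of \<open>x\<close> and \<open>y\<close> appear.\<close>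

lemma congruent_zero:
  assumes r: "congruence r" and b: "(b, lmul x (rmul b y)) \<in> r"
    and xy: "x \<in> Some ` S0 \<or> y \<in> Some ` S0"
  shows "(b, z) \<in> r"
  using xy
proof
  assume "x \<in> Some ` S0"
  then obtain s where s: "s \<in> S0" "x = Some s" by auto
  \<comment> \<open>The factor \<open>w\<close> absorbs \<open>b\<close> and all right multipliers,
    so only the power of \<open>s\<close> is tracked. As \<open>spow s 0\<close> is
    \<open>s\<close>, the base case is the hypothesis itself.\<close>
  have "\<exists>w. (b, spow s n * w) \<in> r" for n
  proof (induction n)
    case 0
    then show ?case using b s by auto
  next
    case (Suc n)
    then obtain w where "(b, spow s n * w) \<in> r" by auto
    then have "(lmul x (rmul b y), lmul x (rmul (spow s n * w) y)) \<in> r"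
      by (rule congruence_lmul_rmul[OF r])
    moreover have "lmul x (rmul (spow s n * w) y) = spow s (Suc n) * rmul w y"
      using s by (cases y) (simp_all add: spow_Suc_left mult.assoc del: spow.simps)
    ultimately show ?case
      using congruence_trans[OF r b] by metis
  qed
  moreover obtain n where "spow s n = z"
    using nilpotent s by blast
  ultimately show ?thesis by (metis zero_mult(1))
next
  assume "y \<in> Some ` S0"
  then obtain s where s: "s \<in> S0" "y = Some s" by auto
  have "\<exists>w. (b, w * spow s n) \<in> r" for n
  proof (induction n)
    case 0
    then show ?case using b s by (metis rmul.simps(2) rmul_lmul spow.simps(1))
  next
    case (Suc n)
    then obtain w where "(b, w * spow s n) \<in> r" by auto
    then have "(lmul x (rmul b y), lmul x (rmul (w * spow s n) y)) \<in> r"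
      by (rule congruence_lmul_rmul[OF r])
    moreover have "lmul x (rmul (w * spow s n) y) = lmul x w * spow s (Suc n)"
      using s by (cases x) (simp_all add: mult.assoc)
    ultimately show ?case
      using congruence_trans[OF r b] by metis
  qed
  moreover obtain n where "spow s n = z"
    using nilpotent s by blast
  ultimately show ?thesis by (metis zero_mult(2))
qed

section \<open>J-classes have at most two elements\<close>

lemma fixed_eq_zero:
  "b = lmul x (rmul b y) \<Longrightarrow> x \<in> Some ` S0 \<or> y \<in> Some ` S0 \<Longrightarrow> b = z"
  using congruent_zero[OF congruence_Id] by auto

text \<open>Going from \<open>b\<close> to \<open>c\<close> and back gives
  \<open>b = (u x) b (y v)\<close>. As \<open>b\<close> is not zero, no multiplier lies in
  \<open>S0\<close>; the left one then fixes \<open>b\<close>, and the right one lies in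
  \<open>S1\<close> because \<open>c\<close> differs from \<open>b\<close>.\<close>

lemma Jcls_right_mult:
  assumes b: "b \<in> S0" and c: "c \<in> Jcls b" "c \<noteq> b"
  shows "\<exists>y\<in>S1. c = b * y"
proof -
  obtain x y where xy: "c = lmul x (rmul b y)"
    using c by (auto simp: mem_Jcls_iff elim: JidE)
  obtain u v where uv: "b = lmul u (rmul c v)"
    using c by (auto simp: mem_Jcls_iff elim: JidE)
  have nz: "b \<noteq> z"
    using c Jid_zero by (auto simp: mem_Jcls_iff)
  have b_eq: "b = lmul (omul u x) (rmul b (omul y v))"
    using xy uv two_sided_mult by metis
  have not_S0: "x \<notin> Some ` S0" "u \<notin> Some ` S0" "y \<notin> Some ` S0"
    using fixed_eq_zero[OF b_eq] nz omul_S0 by blast+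
  have "c = rmul b y"
  proof (cases x rule: option_cases)
    case 1
    then show ?thesis using xy by simp
  next
    case (2 s)
    obtain g where g: "g \<in> S1" "omul u x = Some g"
      using 2 not_S0 S1_mult by (cases u rule: option_cases) auto
    \<comment> \<open>Here \<open>b\<close> has a left factor \<open>g\<close> from
      \<open>S1\<close>, and \<open>s * g = g\<close>.\<close>
    have "s * b = b"
      using b_eq g 2 S1_mult_left by (metis lmul.simps(2))
    then show ?thesis
      using xy 2 by (metis lmul.simps(2) rmul_lmul)
  next
    case 3
    then show ?thesis using not_S0 by auto
  qed
  then show ?thesis
    using c not_S0 by (cases y rule: option_cases) auto
qed

lemma Jcls_S1: "b \<in> S1 \<Longrightarrow> Jcls b \<subseteq> S1"
  using Jid_subset_ideal[OF ideal_S0] S0_or_S1 not_S0_and_S1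
  unfolding mem_Jcls_iff subset_iff by blast

lemma Jcls_pair:
  fixes b c :: 'a
  assumes c: "c \<in> Jcls b" "c \<noteq> b"
  shows "Jcls b = {b, c}"
proof (cases "b \<in> S0")
  case True
  have "c \<in> S0"
    using True c Jid_subset_ideal[OF ideal_S0] by (auto simp: mem_Jcls_iff)
  obtain y where y: "y \<in> S1" "c = b * y"
    using Jcls_right_mult[OF True c] by blast
  have "b \<in> Jcls c"
    using c by (auto simp: mem_Jcls_iff)
  then obtain v where v: "v \<in> S1" "b = c * v"
    using Jcls_right_mult \<open>c \<in> S0\<close> c by blast
  \<comment> \<open>Indeed \<open>b = c * v = b * y * v\<close> and \<open>y * v = v\<close>. Hence
    \<open>y\<close> and \<open>v\<close> are distinct and exhaust \<open>S1\<close>, which leaves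
    only \<open>b\<close> and \<open>c\<close> as right multiples.\<close>
  have bv: "b * v = b"
    using y v S1_mult by (metis mult.assoc)
  have S1: "S1 = {y, v}"
    using card_S1 y v bv c by (metis card_2_iff doubleton_eq_iff insertE singletonD)
  have "d = c" if "d \<in> Jcls b" "d \<noteq> b" for d
    using Jcls_right_mult[OF True that] S1 bv y that by auto
  moreover have "b \<in> Jcls b" by (simp add: Jcls_def)
  ultimately show ?thesis
    using c by blast
next
  case False
  then have "b \<in> S1" using S0_or_S1 by blast
  then have sub: "Jcls b \<subseteq> S1" by (rule Jcls_S1)
  obtain p q where "S1 = {p, q}"
    using card_S1 by (auto simp: card_2_iff)
  then have "S1 = {b, c}"
    using sub c \<open>b \<in> S1\<close> by blast
  moreover have "b \<in> Jcls b" by (simp add: Jcls_def)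
  ultimately show ?thesis
    using sub c by blast
qed

text \<open>Otherwise \<open>b = x * b * y\<close> for some \<open>y\<close> in \<open>S1\<close>;
  then \<open>b\<close> starts with the idempotent \<open>x\<close> and is fixed by it after
  all.\<close>

lemma left_mult_fixed: "x \<in> S1 \<Longrightarrow> b \<in> Jcls (x * b) \<Longrightarrow> b \<in> S0 \<Longrightarrow> x * b = b"
proof (rule ccontr)
  assume x: "x \<in> S1" and J: "b \<in> Jcls (x * b)" and b: "b \<in> S0" and ne: "x * b \<noteq> b"
  then obtain y where "y \<in> S1" "b = x * b * y"
    using Jcls_right_mult[of "x * b" b] S0_mult by metis
  then show False
    using ne x S1_mult_left by (metis mult.assoc)
qed

section \<open>Necessity of conditions (2)--(5)\<close>

lemma Delta_imp_ideals_chain: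
  fixes I K :: "'a set"
  assumes "Delta_semigroup TYPE('a)" "ideal I" "ideal K"
  shows "I \<subseteq> K \<or> K \<subseteq> I"
proof -
  \<comment> \<open>All ideals share \<open>z\<close>, so an ideal is recovered from its Rees
    congruence as the class of \<open>z\<close>.\<close>
  have z: "z \<in> I" "z \<in> K"
    using assms Jid_subset_ideal zero_in_Jid by (metis ideal_def ex_in_conv subsetD)+
  have "rees I \<subseteq> rees K \<or> rees K \<subseteq> rees I"
    using assms congruence_rees by (auto simp: Delta_semigroup_def)
  then show ?thesis
    using z unfolding rees_def by blast
qed

text \<open>If the condition fails at \<open>b * e\<close>, then \<open>b\<close> and
  \<open>b * e\<close> are syntactically equivalent for a set \<open>D\<close> that contains
  \<open>b * e\<close> but not \<open>z\<close>, while \<open>b\<close> lies outside the ideal of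
  \<open>b * e\<close>.\<close>

lemma Delta_imp_right_mult:
  assumes Delta: "Delta_semigroup TYPE('a)" and b: "b \<in> S0"
  shows "b \<in> {b * s | s. s \<in> S1} \<or> {b * s | s. s \<in> S1} \<subseteq> {lmul x (b * c) | x c. c \<in> S0}"
    (is "_ \<or> _ \<subseteq> ?T")
proof (rule ccontr)
  assume neg: "\<not> ?thesis"
  then have not_fixed: "b \<notin> {b * s | s. s \<in> S1}" by blast
  from neg obtain e where e: "e \<in> S1" "b * e \<notin> ?T" by blast
  \<comment> \<open>Testing after right multiplication by \<open>e\<close> hides the difference
    between \<open>b\<close> and \<open>b * e\<close>, because \<open>e * e = e\<close>. Right
    multipliers from \<open>S1\<close> hide it too, and those from \<open>S0\<close> lead into
    \<open>?T\<close> on both sides.\<close>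
  define D where "D = {w. w * e \<notin> ?T}"
  have ne: "b \<noteq> b * e"
    using not_fixed e by auto
  have "b \<notin> Jid (b * e)"
  proof
    assume "b \<in> Jid (b * e)"
    then have "b * e \<in> Jcls b"
      using JidI[of None b "Some e"] by (simp add: mem_Jcls_iff)
    then have "b \<in> Jcls (b * e)" by (auto simp: mem_Jcls_iff)
    then obtain y where "y \<in> S1" "b = b * e * y"
      using Jcls_right_mult[of "b * e" b] ne b S0_mult by metis
    then show False
      using not_fixed e S1_mult by (auto simp: mult.assoc)
  qed
  moreover have "(b, b * e) \<in> syntactic D"
  proof -
    have "lmul x (rmul b y) \<in> D \<longleftrightarrow> lmul x (rmul (b * e) y) \<in> D" for x y
    proof (cases y rule: option_cases)
      case 1
      have "lmul x b * e = lmul x (b * e) * e"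
        using e S1_mult by (cases x) (simp_all add: mult.assoc)
      then show ?thesis using 1 by (simp add: D_def)
    next
      case (2 s)
      then have "rmul b y = rmul (b * e) y"
        using e S1_mult by (simp add: mult.assoc)
      then show ?thesis by simp
    next
      case (3 s)
      have "lmul x (rmul b y) * e = lmul x (b * (s * e))"
        "lmul x (rmul (b * e) y) * e = lmul x (b * (e * s * e))"
        using 3 by (cases x; simp add: mult.assoc)+
      moreover have "s * e \<in> S0" "e * s * e \<in> S0"
        using 3 S0_mult by auto
      ultimately show ?thesis by (auto simp: D_def)
    qed
    then show ?thesis by (simp add: syntactic_def)
  qed
  ultimately have "b * e \<in> D \<longleftrightarrow> z \<in> D"
    using Delta_separation[OF Delta] ne zero_in_Jid by blast
  moreover have "b * e \<in> D"
    using e S1_mult by (simp add: D_def mult.assoc)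
  moreover have "lmul None (b * z) \<in> ?T"
    using z_in_S0 by blast
  then have "z * e \<in> ?T"
    by (simp only: lmul.simps zero_mult)
  then have "z \<notin> D"
    unfolding D_def by blast
  ultimately show False by blast
qed

text \<open>The left-hand analogue, with \<open>T\<close> the products of \<open>b\<close> having a
  multiplier in \<open>S0\<close>. The new difficulty is that \<open>g * b * y\<close> and
  \<open>e * b * y\<close> must be compared for \<open>g\<close> and \<open>y\<close> in
  \<open>S1\<close>; comparability of principal ideals makes them equal.\<close>

lemma Delta_imp_left_mult:
  assumes Delta: "Delta_semigroup TYPE('a)" and b: "b \<in> S0"
  shows "{b} = {s * b | s. s \<in> S1} \<or> {s * b | s. s \<in> S1} \<inter>
    ({rmul (c * b) y | c y. c \<in> S0} \<union> {lmul x (b * c) | x c. c \<in> S0}) \<noteq> {}"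
    (is "_ \<or> _ \<inter> (?L \<union> ?R) \<noteq> {}")
proof (rule ccontr)
  assume neg: "\<not> ?thesis"
  then have not_fixed: "{b} \<noteq> {s * b | s. s \<in> S1}" by argo
  define T where "T = ?L \<union> ?R"
  have disj: "s * b \<notin> T" if "s \<in> S1" for s
    using neg that unfolding T_def by blast
  have absorb: "lmul x (rmul b y) \<in> T" if xy: "x \<in> Some ` S0 \<or> y \<in> Some ` S0" for x y
    using xy
  proof
    assume "x \<in> Some ` S0"
    then obtain s where s: "s \<in> S0" "x = Some s" by auto
    have "lmul x (rmul b y) = rmul (s * b) y"
      using s by (metis lmul.simps(2) rmul_lmul)
    then show ?thesis using s unfolding T_def by blast
  next
    assume "y \<in> Some ` S0"
    then show ?thesis unfolding T_def by auto
  qed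
  obtain e where e: "e \<in> S1" "e * b \<noteq> b"
  proof -
    have "S1 \<noteq> {}" using card_S1 by auto
    then have "{s * b | s. s \<in> S1} = {b}" if "\<forall>s\<in>S1. s * b = b"
      using that by force
    then show ?thesis using not_fixed that by metis
  qed
  define D where "D = {w. e * w \<notin> T}"
  \<comment> \<open>Since \<open>g * b\<close> avoids \<open>T\<close>, both \<open>u\<close> and
    \<open>v\<close> lie outside \<open>S0\<close>. Then \<open>u\<close> is absorbed by
    \<open>h\<close>, and a final factor \<open>y\<close> absorbs \<open>v\<close>.\<close>
  have below: "g * b * y = h * b * y"
    if gh: "g \<in> S1" "h \<in> S1" "g * b \<in> Jid (h * b)" and y: "y \<in> S1" for g h y
  proof -
    obtain u v where uv: "g * b = lmul u (rmul (h * b) v)"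
      using gh by (auto elim: JidE)
    then have eq: "g * b = lmul (omul u (Some h)) (rmul b v)"
      using two_sided_mult[of u "Some h" b None v] by simp
    have "g * b \<notin> T"
      using disj gh by blast
    then have "omul u (Some h) \<notin> Some ` S0" "v \<notin> Some ` S0"
      using absorb[of "omul u (Some h)" v] unfolding eq by blast+
    then have not_S0: "u \<notin> Some ` S0" "v \<notin> Some ` S0"
      using omul_S0 by blast+
    have "omul u (Some h) = Some h"
      using gh not_S0 S1_mult by (cases u rule: option_cases) auto
    then have "g * b = rmul (h * b) v"
      using eq by (metis lmul.simps(2) rmul_lmul)
    then show ?thesis
      using y not_S0 S1_mult by (cases v rule: option_cases) (auto simp: mult.assoc)
  qed
  have right: "g * b * y = h * b * y" if "g \<in> S1" "h \<in> S1" "y \<in> S1" for g h y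
    using Delta_imp_ideals_chain[OF Delta ideal_Jid ideal_Jid, of "g * b" "h * b"]
      below that Jid_self by (metis subsetD)
  have "b \<notin> Jid (e * b)"
  proof
    assume "b \<in> Jid (e * b)"
    then have "b \<in> Jcls (e * b)"
      using JidI[of "Some e" b None] by (simp add: mem_Jcls_iff)
    then show False using left_mult_fixed e b by blast
  qed
  moreover have "(b, e * b) \<in> syntactic D"
  proof -
    have "lmul x (rmul b y) \<in> D \<longleftrightarrow> lmul x (rmul (e * b) y) \<in> D" for x y
    proof (cases "x \<in> Some ` S0 \<or> y \<in> Some ` S0")
      case True
      have "e * lmul x (rmul b y) = lmul (omul (Some e) x) (rmul b y)"
        by (metis lmul.simps(2) lmul_lmul)
      moreover have "e * lmul x (rmul (e * b) y)
          = lmul (omul (omul (Some e) x) (Some e)) (rmul b y)"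
        by (metis lmul.simps(2) lmul_lmul rmul_lmul)
      moreover have "omul (Some e) x \<in> Some ` S0 \<or> y \<in> Some ` S0"
        "omul (omul (Some e) x) (Some e) \<in> Some ` S0 \<or> y \<in> Some ` S0"
        using True omul_S0 by blast+
      ultimately show ?thesis
        using absorb by (simp add: D_def)
    next
      case False
      show ?thesis
      proof (cases x rule: option_cases)
        case 1
        have "e * rmul b y = e * rmul (e * b) y"
          using e S1_mult_left by (metis rmul_lmul lmul.simps(2))
        then show ?thesis using 1 by (simp add: D_def)
      next
        case (2 g)
        have eqs: "e * lmul x (rmul b y) = rmul (g * b) y"
          "e * lmul x (rmul (e * b) y) = rmul (e * b) y"
          using e 2 S1_mult_left by (metis rmul_lmul lmul.simps(2))+
        show ?thesis
        proof (cases y rule: option_cases)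
          case 1
          then show ?thesis
            using eqs disj[of g] disj[of e] e 2 by (simp add: D_def)
        next
          case (2 s)
          then show ?thesis
            using eqs right[of g e s] e \<open>g \<in> S1\<close> by (simp add: D_def)
        next
          case 3
          then show ?thesis using False by auto
        qed
      next
        case 3
        then show ?thesis using False by auto
      qed
    qed
    then show ?thesis by (simp add: syntactic_def)
  qed
  ultimately have "e * b \<in> D \<longleftrightarrow> z \<in> D"
    using Delta_separation[OF Delta] e(2) zero_in_Jid by metis
  moreover have "e * b \<in> D"
    using e S1_mult_left disj by (simp add: D_def)
  moreover have "z \<in> T"
    using absorb[of None "Some z"] z_in_S0 by simp
  then have "z \<notin> D"
    by (simp add: D_def)
  ultimately show False by blast
qed

text \<open>Failure of the condition says exactly that the syntactic congruence of
  \<open>Jcls a\<close> relates the two elements of \<open>Jcls b\<close>. Both lie strictly above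
  \<open>Iid b\<close>, so all of \<open>Iid b\<close> is J-equivalent to \<open>a\<close> and to
  \<open>z\<close>, which forces \<open>Iid b\<close> to be \<open>{z}\<close>.\<close>

lemma Delta_imp_Jcls_split:
  assumes Delta: "Delta_semigroup TYPE('a)" and card: "card (Jcls b) = 2"
    and I: "Iid b \<noteq> {z}" and a: "a \<in> Iid b"
  shows "\<exists>x y. sandwich x (Jcls b) y \<inter> Jcls a \<noteq> {} \<and> \<not> sandwich x (Jcls b) y \<subseteq> Jcls a"
proof (rule ccontr)
  assume neg: "\<not> ?thesis"
  obtain p q where pq: "Jcls b = {p, q}" "p \<noteq> q"
    using card by (auto simp: card_2_iff)
  have "lmul x (rmul p y) \<in> Jcls a \<longleftrightarrow> lmul x (rmul q y) \<in> Jcls a" for x y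
  proof -
    have eq: "sandwich x (Jcls b) y = {lmul x (rmul p y), lmul x (rmul q y)}"
      using pq by (auto simp: sandwich_def)
    have "sandwich x (Jcls b) y \<inter> Jcls a = {} \<or> sandwich x (Jcls b) y \<subseteq> Jcls a"
      using neg by blast
    then show ?thesis unfolding eq by auto
  qed
  then have syn: "(p, q) \<in> syntactic (Jcls a)"
    by (simp add: syntactic_def)
  have above: "p \<notin> Jid c" if "c \<in> Iid b" for c
  proof -
    have "p \<in> Jcls b" using pq by auto
    then show ?thesis
      using that Jid_trans by (auto simp: mem_Jcls_iff mem_Iid_iff)
  qed
  have sep: "c \<in> Jcls a \<longleftrightarrow> z \<in> Jcls a" if "c \<in> Iid b" for c
    using Delta_separation[OF Delta syn pq(2) above[OF that] zero_in_Jid] .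
  have "a \<in> Jcls a" by (simp add: mem_Jcls_iff)
  then have "z \<in> Jcls a" using sep a by blast
  then have "a = z"
    using Jid_zero by (auto simp: mem_Jcls_iff)
  moreover obtain c where "c \<in> Iid b" "c \<noteq> z"
    using I a by blast
  ultimately show False
    using sep[of c] Jid_zero by (auto simp: mem_Jcls_iff)
qed

section \<open>The zero class of a congruence\<close>

lemma ideal_zero_class: "congruence r \<Longrightarrow> ideal {a. (a, z) \<in> r}"
  unfolding ideal_def
  by (metis (no_types, lifting) congruence_def congruence_refl empty_iff mem_Collect_eq zero_mult)

lemma zero_class_Jid: "congruence r \<Longrightarrow> (b, z) \<in> r \<Longrightarrow> a \<in> Jid b \<Longrightarrow> (a, z) \<in> r"
  using Jid_subset_ideal[OF ideal_zero_class] by blast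

text \<open>As \<open>b\<close> is idempotent, it is congruent to every power of \<open>a\<close>,
  and one of these is zero.\<close>

lemma S1_congruent_zero:
  assumes r: "congruence r" and ab: "(a, b) \<in> r" and a: "a \<in> S0" and b: "b \<in> S1"
  shows "(b, z) \<in> r"
proof -
  have "(b, spow a n) \<in> r" for n
  proof (induction n)
    case 0
    then show ?case using ab r congruence_sym by simp
  next
    case (Suc n)
    then have "(b * b, spow a n * b) \<in> r" "(spow a n * b, spow a n * a) \<in> r"
      using r ab congruence_sym[OF r ab] unfolding congruence_def by blast+
    then show ?case
      using r congruence_trans b S1_mult by (metis spow.simps(2))
  qed
  then show ?thesis using nilpotent a by metis
qed

end

section \<open>The conditions imply the chain condition on congruences\<close>

locale T2R_conditions = nil_right_zero S0 S1 z
  for S0 S1 :: "('a::semigroup_mult) set" and z :: 'a +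
  assumes chain: "\<And>I K :: 'a set. ideal I \<Longrightarrow> ideal K \<Longrightarrow> I \<subseteq> K \<or> K \<subseteq> I"
    and right_mult: "\<And>b. b \<in> S0 \<Longrightarrow> b \<in> {b * s | s. s \<in> S1} \<or>
          {b * s | s. s \<in> S1} \<subseteq> {lmul x (b * c) | x c. c \<in> S0}"
    and left_mult: "\<And>b. b \<in> S0 \<Longrightarrow> {b} = {s * b | s. s \<in> S1} \<or>
          {s * b | s. s \<in> S1} \<inter>
            ({rmul (c * b) y | c y. c \<in> S0} \<union> {lmul x (b * c) | x c. c \<in> S0}) \<noteq> {}"
    and Jcls_split: "\<And>b a. card (Jcls b) = 2 \<Longrightarrow> Iid b \<noteq> {z} \<Longrightarrow> a \<in> Iid b \<Longrightarrow>
          \<exists>x y. sandwich x (Jcls b) y \<inter> Jcls a \<noteq> {} \<and> \<not> sandwich x (Jcls b) y \<subseteq> Jcls a"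
begin

lemma Jid_total:
  fixes a b :: 'a
  shows "a \<in> Jid b \<or> b \<in> Jid a"
  using chain[OF ideal_Jid ideal_Jid, of a b] Jid_self by blast

text \<open>An equation \<open>b = b * t\<close> would give \<open>b = (b * s) * t\<close>, against
  the strict drop. So condition (3) supplies a multiplier from \<open>S0\<close>, and iteration
  leads to zero.\<close>

lemma right_mult_congruent_zero:
  assumes r: "congruence r" and b: "b \<in> S0" "s \<in> S1" "(b, b * s) \<in> r" "b \<notin> Jid (b * s)"
  shows "(b, z) \<in> r"
proof -
  have "b \<noteq> b * t" if "t \<in> S1" for t
  proof
    assume "b = b * t"
    then have "b = lmul None (rmul (b * s) (Some t))"
      using S1_mult b that by (simp add: mult.assoc)
    then show False using b JidI by metis
  qed
  then have "b * s \<in> {lmul x (b * c) | x c. c \<in> S0}"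
    using right_mult b by blast
  then obtain x c where "c \<in> S0" "b * s = lmul x (rmul b (Some c))" by auto
  then show ?thesis
    using congruent_zero r b by (metis imageI)
qed

lemma left_mult_congruent_zero:
  assumes r: "congruence r" and b: "b \<in> S0" "s \<in> S1" "(b, s * b) \<in> r" "b \<noteq> s * b"
  shows "(b, z) \<in> r"
proof -
  have "s * b \<in> {s * b | s. s \<in> S1}"
    using b by blast
  then have "{b} \<noteq> {s * b | s. s \<in> S1}"
    using b by (metis singletonD)
  then obtain t where t: "t \<in> S1"
    "t * b \<in> {rmul (c * b) y | c y. c \<in> S0} \<union> {lmul x (b * c) | x c. c \<in> S0}"
    using left_mult b by blast
  have "\<exists>x y. t * b = lmul x (rmul b y) \<and> (x \<in> Some ` S0 \<or> y \<in> Some ` S0)"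
  proof -
    consider c y where "c \<in> S0" "t * b = rmul (c * b) y" | x c where "c \<in> S0" "t * b = lmul x (b * c)"
      using t by blast
    then show ?thesis
    proof cases
      case 1
      then have "t * b = lmul (Some c) (rmul b y)"
        by (metis lmul.simps(2) rmul_lmul)
      then show ?thesis using 1 by blast
    next
      case 2
      then have "t * b = lmul x (rmul b (Some c))" by simp
      then show ?thesis using 2 by blast
    qed
  qed
  \<comment> \<open>Condition (4) chooses \<open>t\<close>, not \<open>s\<close>; the bridge is
    \<open>t * (s * b) = s * b\<close>.\<close>
  moreover have "(b, t * b) \<in> r"
  proof -
    have "(t * b, t * (s * b)) \<in> r"
      using r b by (auto simp: congruence_def)
    then have "(t * b, s * b) \<in> r"
      using S1_mult_left t b by simp
    then show ?thesis
      using r b congruence_sym congruence_trans by blast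
  qed
  ultimately show ?thesis
    using congruent_zero r by metis
qed

text \<open>For \<open>a = x b y\<close> without multipliers in \<open>S0\<close>, the element
  \<open>b y\<close> is still congruent to \<open>b\<close>. The drop from \<open>b\<close> to
  \<open>a\<close> is thus split into a right step, governed by (3), and a left step, governed by
  (4).\<close>

lemma congruent_strictly_below:
  assumes r: "congruence r" and ab: "(a, b) \<in> r" and J: "a \<in> Jid b" "b \<notin> Jid a"
  shows "(b, z) \<in> r"
proof (cases "b \<in> S0")
  case False
  then have b: "b \<in> S1" using S0_or_S1 by blast
  have "a \<notin> S1"
  proof
    assume "a \<in> S1"
    then have "b = lmul None (rmul a (Some b))"
      using b S1_mult by simp
    then show False using J JidI by metis
  qed
  then show ?thesis
    using S1_congruent_zero r ab b S0_or_S1 by blast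
next
  case b: True
  have ba: "(b, a) \<in> r" using r ab congruence_sym by blast
  obtain x y where xy: "a = lmul x (rmul b y)"
    using J by (auto elim: JidE)
  show ?thesis
  proof (cases "x \<in> Some ` S0 \<or> y \<in> Some ` S0")
    case True
    then show ?thesis using congruent_zero[OF r] ba xy by blast
  next
    case False
    define b' where "b' = rmul b y"
    have b': "b' \<in> S0" "b' \<in> Jid b"
      unfolding b'_def using b S0_mult JidI[of None b y] by (cases y; simp)+
    have bb': "(b, b') \<in> r"
    proof -
      have "(rmul b y, rmul a y) \<in> r"
        using congruence_lmul_rmul[OF r ba, of None y] by simp
      \<comment> \<open>Idempotency of \<open>y\<close> gives \<open>a y = a\<close>, so multiplying
        \<open>b\<close> and \<open>a\<close> by \<open>y\<close> relates \<open>b'\<close> to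
        \<open>a\<close>.\<close>
      moreover have "omul y y = y"
        using False S1_mult by (cases y rule: option_cases) auto
      then have "rmul a y = a"
        using xy by (simp add: rmul_lmul rmul_rmul)
      ultimately show ?thesis
        unfolding b'_def using r ab congruence_sym congruence_trans by metis
    qed
    show ?thesis
    proof (cases "b \<in> Jid b'")
      case False
      then obtain s where "s \<in> S1" "b' = b * s"
        using \<open>\<not> (x \<in> Some ` S0 \<or> y \<in> Some ` S0)\<close>
        by (cases y rule: option_cases) (auto simp: b'_def)
      then show ?thesis
        using right_mult_congruent_zero[OF r b] bb' False by blast
    next
      case True
      then have "a \<noteq> b'" using J by auto
      then obtain s where s: "s \<in> S1" "a = s * b'"
        using False xy by (cases x rule: option_cases) (auto simp: b'_def)
      moreover have "(b', a) \<in> r"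
        using r bb' ba congruence_sym congruence_trans by blast
      ultimately have "(b', z) \<in> r"
        using left_mult_congruent_zero[OF r b'(1)] \<open>a \<noteq> b'\<close> by metis
      then show ?thesis
        using r bb' congruence_trans by blast
    qed
  qed
qed

lemma congruent_not_J_equivalent:
  assumes r: "congruence r" and ab: "(a, b) \<in> r" and J: "a \<notin> Jcls b"
  shows "(a, z) \<in> r \<and> (b, z) \<in> r"
proof -
  have ba: "(b, a) \<in> r" using r ab congruence_sym by blast
  have "(b, z) \<in> r \<or> (a, z) \<in> r"
    using Jid_total[of a b] J congruent_strictly_below[OF r ab] congruent_strictly_below[OF r ba]
    by (auto simp: mem_Jcls_iff)
  then show ?thesis
    using r ab ba congruence_trans by blast
qed

text \<open>Condition (5) yields a translate of the pair with exactly one member in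
  \<open>Jcls a\<close>. Its members are congruent but not J-equivalent, hence both congruent to
  zero, and \<open>a\<close> with them.\<close>

lemma collapsed_Jcls_Iid:
  assumes r: "congruence r" and pq: "(p, q) \<in> r" "p \<noteq> q" "q \<in> Jcls p" and a: "a \<in> Iid p"
  shows "(a, z) \<in> r"
proof (cases "Iid p = {z}")
  case True
  then show ?thesis using a r congruence_refl by auto
next
  case False
  have J: "Jcls p = {p, q}"
    using Jcls_pair pq by blast
  then have "card (Jcls p) = 2" using pq by simp
  then obtain x y where xy: "sandwich x (Jcls p) y \<inter> Jcls a \<noteq> {}"
    "\<not> sandwich x (Jcls p) y \<subseteq> Jcls a"
    using Jcls_split False a by blast
  let ?p = "lmul x (rmul p y)" and ?q = "lmul x (rmul q y)"
  have "sandwich x (Jcls p) y = {?p, ?q}"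
    using J by (auto simp: sandwich_def)
  then have cases: "?p \<in> Jcls a \<and> ?q \<notin> Jcls a \<or> ?q \<in> Jcls a \<and> ?p \<notin> Jcls a"
    using xy by auto
  then have "?p \<notin> Jcls ?q"
    unfolding mem_Jcls_iff by (metis Jid_trans)
  moreover have "(?p, ?q) \<in> r"
    using congruence_lmul_rmul r pq by blast
  ultimately have "(?p, z) \<in> r" "(?q, z) \<in> r"
    using congruent_not_J_equivalent r by blast+
  then show ?thesis
    using cases zero_class_Jid[OF r] by (auto simp: mem_Jcls_iff)
qed

section \<open>Comparing two congruences through their zero classes\<close>

lemma subset_if_zero_class_less:
  assumes r: "congruence r" and s: "congruence s"
    and sub: "\<And>a. (a, z) \<in> r \<Longrightarrow> (a, z) \<in> s" and c: "(c, z) \<in> s" "(c, z) \<notin> r"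
  shows "r \<subseteq> s"
proof (rule subrelI)
  fix p q assume pq: "(p, q) \<in> r"
  show "(p, q) \<in> s"
  proof (cases "p = q \<or> q \<notin> Jcls p")
    case True
    then show ?thesis
      using congruent_not_J_equivalent[OF r] pq sub s congruence_refl congruence_sym congruence_trans r
      by metis
  next
    case False
    \<comment> \<open>Collapsing the class of \<open>p\<close> puts \<open>Iid p\<close> into the
      zero class of \<open>r\<close>, which misses \<open>c\<close>. So \<open>p\<close> and
      \<open>q\<close> lie in the ideal of \<open>c\<close>, which \<open>s\<close> sends to
      zero.\<close>
    then have "c \<notin> Iid p"
      using collapsed_Jcls_Iid[OF r pq] c by blast
    then have "p \<in> Jid c"
      using Jid_total by (auto simp: mem_Iid_iff)
    moreover have "q \<in> Jid p"
      using False by (auto simp: mem_Jcls_iff)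
    ultimately have "(p, z) \<in> s" "(q, z) \<in> s"
      using zero_class_Jid[OF s] c Jid_trans by blast+
    then show ?thesis
      using s congruence_sym congruence_trans by blast
  qed
qed

text \<open>A pair in one congruence only is a two-element J-class just above the common zero class.
  Two such classes coincide because principal ideals form a chain.\<close>

lemma comparable_if_zero_class_eq:
  assumes r: "congruence r" and s: "congruence s" and eq: "\<And>a. (a, z) \<in> r \<longleftrightarrow> (a, z) \<in> s"
  shows "r \<subseteq> s \<or> s \<subseteq> r"
proof (rule ccontr)
  assume "\<not> ?thesis"
  then obtain p q u v where pq: "(p, q) \<in> r" "(p, q) \<notin> s" and uv: "(u, v) \<in> s" "(u, v) \<notin> r"
    by auto
  have not_zero: "(p, z) \<notin> r" "(u, z) \<notin> r"
    using pq uv eq r s congruence_sym congruence_trans by metis+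
  have J: "q \<in> Jcls p" "v \<in> Jcls u"
    using congruent_not_J_equivalent not_zero eq r s pq uv congruence_sym by metis+
  have ne: "p \<noteq> q" "u \<noteq> v"
    using pq uv r s congruence_refl by metis+
  have "p \<notin> Iid u" "u \<notin> Iid p"
    using collapsed_Jcls_Iid[OF r pq(1) ne(1) J(1)] collapsed_Jcls_Iid[OF s uv(1) ne(2) J(2)]
      not_zero eq by blast+
  then have "u \<in> Jcls p"
    using Jid_total[of u p] by (auto simp: mem_Iid_iff mem_Jcls_iff)
  then have "Jcls u = Jcls p"
    by (auto simp: Jcls_def)
  then have "{u, v} = {p, q}"
    using Jcls_pair J ne by metis
  then show False
    using pq uv r congruence_sym by (metis doubleton_eq_iff)
qed

lemma Delta: "Delta_semigroup TYPE('a)"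
proof -
  have "r \<subseteq> s \<or> s \<subseteq> r" if rs: "congruence r" "congruence s" for r s :: "'a rel"
  proof -
    let ?R = "{a. (a, z) \<in> r}" and ?S = "{a. (a, z) \<in> s}"
    have "?R \<subseteq> ?S \<or> ?S \<subseteq> ?R"
      using chain ideal_zero_class rs by blast
    then consider "?R = ?S" | "?R \<subset> ?S" | "?S \<subset> ?R" by blast
    then show ?thesis
    proof cases
      case 1
      then show ?thesis
        using comparable_if_zero_class_eq[OF rs] by blast
    next
      case 2
      then obtain c where "(c, z) \<in> s" "(c, z) \<notin> r" by blast
      then show ?thesis
        using 2 subset_if_zero_class_less[OF rs] by blast
    next
      case 3
      then obtain c where "(c, z) \<in> r" "(c, z) \<notin> s" by blast
      then show ?thesis
        using 3 subset_if_zero_class_less[OF rs(2) rs(1)] by blast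
    qed
  qed
  then show ?thesis by (auto simp: Delta_semigroup_def)
qed

end

section \<open>Assembling the two directions of the characterisation\<close>

theorem theorem1:
  fixes t :: "'a::semigroup_mult itself"
  shows "T2R t \<longleftrightarrow>
    (\<exists>(S0::'a set) S1 z.
       \<comment> \<open>(1)\<close>
       semilattice_of S0 S1 \<and> nil_with_zero S0 z \<and> nontrivial S0 \<and>
       right_zero S1 \<and> card S1 = 2 \<and> {u * v | u v. u \<in> S0 \<and> v \<in> S1} \<subseteq> S0 \<and>
       \<comment> \<open>(2)\<close>
       (\<forall>I K :: 'a set. ideal I \<and> ideal K \<longrightarrow> I \<subseteq> K \<or> K \<subseteq> I) \<and>
       \<comment> \<open>(3)\<close>
       (\<forall>b\<in>S0. b \<in> {b * s | s. s \<in> S1} \<or>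
          {b * s | s. s \<in> S1} \<subseteq> {lmul x (b * c) | x c. c \<in> S0}) \<and>
       \<comment> \<open>(4)\<close>
       (\<forall>b\<in>S0. {b} = {s * b | s. s \<in> S1} \<or>
          {s * b | s. s \<in> S1} \<inter>
            ({rmul (c * b) y | c y. c \<in> S0} \<union> {lmul x (b * c) | x c. c \<in> S0}) \<noteq> {}) \<and>
       \<comment> \<open>(5)\<close>
       (\<forall>b a. card (Jcls b) = 2 \<and> Iid b \<noteq> {z} \<and> a \<in> Iid b \<longrightarrow>
          (\<exists>x y. sandwich x (Jcls b) y \<inter> Jcls a \<noteq> {} \<and>
                 \<not> sandwich x (Jcls b) y \<subseteq> Jcls a)))"
    (is "_ \<longleftrightarrow> (\<exists>S0 S1 z. ?C S0 S1 z)")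
proof
  assume T2R: "T2R t"
  then have Delta: "Delta_semigroup TYPE('a)"
    by (simp add: T2R_def Delta_semigroup_def)
  obtain S0 S1 :: "'a set" and z where S: "semilattice_of S0 S1" "nil_with_zero S0 z"
    "nontrivial S0" "right_zero S1" "card S1 = 2"
    using T2R unfolding T2R_def by blast
  interpret nil_right_zero S0 S1 z
    using S by unfold_locales
  have C: "?C S0 S1 z"
  proof (intro conjI ballI allI impI S Delta_imp_right_mult[OF Delta] Delta_imp_left_mult[OF Delta])
    show "{u * v | u v. u \<in> S0 \<and> v \<in> S1} \<subseteq> S0"
      using S0_mult by auto
  next
    fix I K :: "'a set"
    assume "ideal I \<and> ideal K"
    then show "I \<subseteq> K \<or> K \<subseteq> I"
      using Delta_imp_ideals_chain[OF Delta] by blast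
  next
    fix b a
    assume "card (Jcls b) = 2 \<and> Iid b \<noteq> {z} \<and> a \<in> Iid b"
    then show "\<exists>x y. sandwich x (Jcls b) y \<inter> Jcls a \<noteq> {} \<and>
        \<not> sandwich x (Jcls b) y \<subseteq> Jcls a"
      by (elim conjE) (rule Delta_imp_Jcls_split[OF Delta])
  qed
  show "\<exists>S0 S1 z. ?C S0 S1 z"
    by (intro exI) (rule C)
next
  assume "\<exists>S0 S1 z. ?C S0 S1 z"
  then obtain S0 S1 :: "'a set" and z where C: "?C S0 S1 z"
    by (elim exE) (rule that)
  then interpret T2R_conditions S0 S1 z
    by unfold_locales blast+
  have "Delta_semigroup t"
    using Delta by (simp add: Delta_semigroup_def)
  moreover have "nontrivial S0"
    using C by (elim conjE)
  ultimately show "T2R t"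
    using semilattice nil right_zero card_S1 unfolding T2R_def by blast
qed

end
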